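(* Let $\mathcal{K}^{\langle 0\rangle}$ be a simple nested fractal in $\mathbb{R}^2$ with $k=2^n$ essential fixed points, where $n\in\mathbb{N}$, $n>1$. Then the corresponding unbounded simple nested fractal $\mathcal{K}^{\langle\infty\rangle}$ has the good labelling property (GLP).
   Context: Simple nested fractal (SNF). Let $\Psi_i:\mathbb{R}^2\to\mathbb{R}^2$, $\Psi_i(x)=x/L+\nu_i$, $i=1,\dots,N$, with $L>1$, $\nu_i\in\mathbb{R}^2$, and one of the $\nu_i$ equal to $0$. $\mathcal{K}^{\langle 0\rangle}$ is the unique nonempty compact set with $\mathcal{K}^{\langle 0\rangle}=\bigcup_{i=1}^N\Psi_i(\mathcal{K}^{\langle 0\rangle})$. Let $F$ be the set of fixed points of the $\Psi_i$. A point $x\in F$ is an essential fixed point if there are another fixed point $y\in F$ and two different maps $\Psi_i,\Psi_j$ with $\Psi_i(x)=\Psi_j(y)$. $V_0^{\langle 0\rangle}$ is the set of essential fixed points and $k=\#V_0^{\langle 0\rangle}$. $\mathcal{K}^{\langle 0\rangle}$ is an SNF if: (1) $k\ge 2$; (2) (Open Set Condition) there is an open $U\subset\mathbb{R}^2$ with $\Psi_i(U)\cap\Psi_j(U)=\emptyset$ for $i\ne j$ and $\bigcup_i\Psi_i(U)\subseteq U$; (3) (Nesting) $\Psi_i(\mathcal{K}^{\langle 0\rangle})\cap\Psi_j(\mathcal{K}^{\langle 0\rangle})=\Psi_i(V_0^{\langle 0\rangle})\cap\Psi_j(V_0^{\langle 0\rangle})$ for $i\neq j$; (4) (Symmetry)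 for $x,y\in V_0^{\langle 0\rangle}$ let $S_{x,y}$ be the reflection in the line perpendicularly bisecting $[x,y]$; for all $i\in\{1,\dots,N\}$ and all $x,y\in V_0^{\langle 0\rangle}$ there is $j\in\{1,\dots,N\}$ with $S_{x,y}(\Psi_i(V_0^{\langle 0\rangle}))=\Psi_j(V_0^{\langle 0\rangle})$; (5) (Connectivity) the graph on $V_{-1}^{\langle 0\rangle}=\bigcup_i\Psi_i(V_0^{\langle 0\rangle})$ in which $x,y$ are joined iff $x,y\in\Psi_i(\mathcal{K}^{\langle 0\rangle})$ for some $i$ is connected. For $k\ge 3$ it is known that $V_0^{\langle 0\rangle}$ is the vertex set of a regular $k$-gon. Complexes. $\mathcal{K}^{\langle M\rangle}=L^M\mathcal{K}^{\langle 0\rangle}$ and $\mathcal{K}^{\langle\infty\rangle}=\bigcup_{M\ge 0}\mathcal{K}^{\langle M\rangle}$ (the unbounded SNF). A $0$-complex is a set $\Delta_0=\mathcal{K}^{\langle 0\rangle}+\nu_{\Delta_0}\subset\mathcal{K}^{\langle\infty\rangle}$ with $\nu_{\Delta_0}=\sum_{j=1}^{J}L^j\nu_{i_j}$, $J\ge 1$, $\nu_{i_j}\in\{\nu_1,\dots,\nu_N\}$; its vertex set is $V(\Delta_0)=V_0^{\langle 0\rangle}+\nu_{\Delta_0}$. $V_0^{\langle\infty\rangle}$ is the set of vertices of all $0$-complexes. GLP. Let $\mathcal{A}$ be a set of $k$ labels, and let $\mathcal{R}_0$ be the set of the $k$ rotations around the barycenter of $\mathcal{K}^{\langle 0\rangle}$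 mapping $V_0^{\langle 0\rangle}$ onto itself. $\mathcal{K}^{\langle\infty\rangle}$ has the GLP if there is $\ell:V_0^{\langle\infty\rangle}\to\mathcal{A}$ whose restriction to $V_0^{\langle 0\rangle}$ is a bijection onto $\mathcal{A}$ and such that for every $0$-complex $\Delta_0=\mathcal{K}^{\langle 0\rangle}+\nu_{\Delta_0}$ there is $R_{\Delta_0}\in\mathcal{R}_0$ with $\ell(v)=\ell(R_{\Delta_0}(v-\nu_{\Delta_0}))$ for all $v\in V(\Delta_0)$. (By self-similarity the analogous property for complexes of any other scale $L^M$, $M\in\mathbb{Z}$, is equivalent.) *)

theory Defs
  imports "HOL-Analysis.Analysis"
begin

section \<open>Iterated function systems of homotheties of the plane\<close>

text \<open>The system is given by the scaling factor \<open>L\<close>, the number \<open>N\<close> of maps and the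
  translation vectors \<open>\<nu> 1, \<dots>, \<nu> N\<close>; other values of \<open>\<nu>\<close> are irrelevant.\<close>

definition sim :: "real \<Rightarrow> (nat \<Rightarrow> real ^ 2) \<Rightarrow> nat \<Rightarrow> real ^ 2 \<Rightarrow> real ^ 2" where
  "sim L \<nu> i x = x /\<^sub>R L + \<nu> i"

text \<open>For \<open>L > 1\<close> and \<open>N \<ge> 1\<close> exactly one set has the following property.\<close>

definition is_attractor :: "real \<Rightarrow> nat \<Rightarrow> (nat \<Rightarrow> real ^ 2) \<Rightarrow> (real ^ 2) set \<Rightarrow> bool" where
  "is_attractor L N \<nu> K \<longleftrightarrow>
     K \<noteq> {} \<and> compact K \<and> K = (\<Union>i\<in>{1..N}. sim L \<nu> i ` K)"

definition fixed_points :: "real \<Rightarrow> nat \<Rightarrow> (nat \<Rightarrow> real ^ 2) \<Rightarrow> (real ^ 2) set" where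
  "fixed_points L N \<nu> = {x. \<exists>i\<in>{1..N}. sim L \<nu> i x = x}"

definition essential_fixed_points :: "real \<Rightarrow> nat \<Rightarrow> (nat \<Rightarrow> real ^ 2) \<Rightarrow> (real ^ 2) set" where
  "essential_fixed_points L N \<nu> =
     {x \<in> fixed_points L N \<nu>.
        \<exists>y \<in> fixed_points L N \<nu>. y \<noteq> x \<and>
          (\<exists>i\<in>{1..N}. \<exists>j\<in>{1..N}. sim L \<nu> i \<noteq> sim L \<nu> j \<and> sim L \<nu> i x = sim L \<nu> j y)}"


section \<open>Simple nested fractals\<close>

text \<open>The open set is required to be nonempty, since for the empty set the condition is void.\<close>

definition open_set_condition :: "real \<Rightarrow> nat \<Rightarrow> (nat \<Rightarrow> real ^ 2) \<Rightarrow> bool" where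
  "open_set_condition L N \<nu> \<longleftrightarrow>
     (\<exists>U. open U \<and> U \<noteq> {} \<and>
        (\<forall>i\<in>{1..N}. \<forall>j\<in>{1..N}. i \<noteq> j \<longrightarrow> sim L \<nu> i ` U \<inter> sim L \<nu> j ` U = {}) \<and>
        (\<Union>i\<in>{1..N}. sim L \<nu> i ` U) \<subseteq> U)"

definition nesting :: "real \<Rightarrow> nat \<Rightarrow> (nat \<Rightarrow> real ^ 2) \<Rightarrow> (real ^ 2) set \<Rightarrow> bool" where
  "nesting L N \<nu> K \<longleftrightarrow>
     (\<forall>i\<in>{1..N}. \<forall>j\<in>{1..N}. i \<noteq> j \<longrightarrow>
        sim L \<nu> i ` K \<inter> sim L \<nu> j ` K =
        sim L \<nu> i ` essential_fixed_points L N \<nu> \<inter> sim L \<nu> j ` essential_fixed_points L N \<nu>)"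

text \<open>Reflection in the perpendicular bisector of the segment from \<open>x\<close> to \<open>y\<close>,
  for \<open>x \<noteq> y\<close>.\<close>

definition bisector_reflection :: "real ^ 2 \<Rightarrow> real ^ 2 \<Rightarrow> real ^ 2 \<Rightarrow> real ^ 2" where
  "bisector_reflection x y z =
     z - (2 * ((z - midpoint x y) \<bullet> (y - x)) / ((y - x) \<bullet> (y - x))) *\<^sub>R (y - x)"

definition symmetry_condition :: "real \<Rightarrow> nat \<Rightarrow> (nat \<Rightarrow> real ^ 2) \<Rightarrow> bool" where
  "symmetry_condition L N \<nu> \<longleftrightarrow>
     (\<forall>i\<in>{1..N}. \<forall>x \<in> essential_fixed_points L N \<nu>. \<forall>y \<in> essential_fixed_points L N \<nu>.
        x \<noteq> y \<longrightarrow>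
        (\<exists>j\<in>{1..N}. bisector_reflection x y ` (sim L \<nu> i ` essential_fixed_points L N \<nu>) =
                      sim L \<nu> j ` essential_fixed_points L N \<nu>))"

definition first_vertices :: "real \<Rightarrow> nat \<Rightarrow> (nat \<Rightarrow> real ^ 2) \<Rightarrow> (real ^ 2) set" where
  "first_vertices L N \<nu> = (\<Union>i\<in>{1..N}. sim L \<nu> i ` essential_fixed_points L N \<nu>)"

definition first_edges ::
  "real \<Rightarrow> nat \<Rightarrow> (nat \<Rightarrow> real ^ 2) \<Rightarrow> (real ^ 2) set \<Rightarrow> ((real ^ 2) \<times> (real ^ 2)) set" where
  "first_edges L N \<nu> K =
     {(x, y). x \<in> first_vertices L N \<nu> \<and> y \<in> first_vertices L N \<nu> \<and>
              (\<exists>i\<in>{1..N}. x \<in> sim L \<nu> i ` K \<and> y \<in> sim L \<nu> i ` K)}"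

definition connectivity_condition ::
  "real \<Rightarrow> nat \<Rightarrow> (nat \<Rightarrow> real ^ 2) \<Rightarrow> (real ^ 2) set \<Rightarrow> bool" where
  "connectivity_condition L N \<nu> K \<longleftrightarrow>
     (\<forall>x \<in> first_vertices L N \<nu>. \<forall>y \<in> first_vertices L N \<nu>. (x, y) \<in> (first_edges L N \<nu> K)\<^sup>*)"

definition simple_nested_fractal ::
  "real \<Rightarrow> nat \<Rightarrow> (nat \<Rightarrow> real ^ 2) \<Rightarrow> (real ^ 2) set \<Rightarrow> bool" where
  "simple_nested_fractal L N \<nu> K \<longleftrightarrow>
     L > 1 \<and> (\<exists>i\<in>{1..N}. \<nu> i = 0) \<and> is_attractor L N \<nu> K \<and>
     card (essential_fixed_points L N \<nu>) \<ge> 2 \<and>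
     open_set_condition L N \<nu> \<and>
     nesting L N \<nu> K \<and>
     symmetry_condition L N \<nu> \<and>
     connectivity_condition L N \<nu> K"


section \<open>The unbounded fractal and its 0-complexes\<close>

definition blow_up :: "real \<Rightarrow> (real ^ 2) set \<Rightarrow> nat \<Rightarrow> (real ^ 2) set" where
  "blow_up L K M = (\<lambda>x. L ^ M *\<^sub>R x) ` K"

definition unbounded_fractal :: "real \<Rightarrow> (real ^ 2) set \<Rightarrow> (real ^ 2) set" where
  "unbounded_fractal L K = (\<Union>M. blow_up L K M)"

text \<open>A 0-complex is represented by its translation vector \<open>t\<close>: the 0-complex itself is
  the translate of \<open>K\<close> by \<open>t\<close>. As \<open>K\<close> is nonempty and bounded, \<open>t\<close> is determined by the
  set.\<close>

definition zero_complex_shifts ::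
  "real \<Rightarrow> nat \<Rightarrow> (nat \<Rightarrow> real ^ 2) \<Rightarrow> (real ^ 2) set \<Rightarrow> (real ^ 2) set" where
  "zero_complex_shifts L N \<nu> K =
     {t. (\<exists>J\<ge>1. \<exists>idx. (\<forall>j\<in>{1..J}. idx j \<in> {1..N}) \<and> t = (\<Sum>j=1..J. L ^ j *\<^sub>R \<nu> (idx j))) \<and>
         (\<lambda>x. x + t) ` K \<subseteq> unbounded_fractal L K}"

definition complex_vertices ::
  "real \<Rightarrow> nat \<Rightarrow> (nat \<Rightarrow> real ^ 2) \<Rightarrow> real ^ 2 \<Rightarrow> (real ^ 2) set" where
  "complex_vertices L N \<nu> t = (\<lambda>x. x + t) ` essential_fixed_points L N \<nu>"

definition all_vertices ::
  "real \<Rightarrow> nat \<Rightarrow> (nat \<Rightarrow> real ^ 2) \<Rightarrow> (real ^ 2) set \<Rightarrow> (real ^ 2) set" where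
  "all_vertices L N \<nu> K = (\<Union>t \<in> zero_complex_shifts L N \<nu> K. complex_vertices L N \<nu> t)"


section \<open>The good labelling property\<close>

definition centroid :: "(real ^ 2) set \<Rightarrow> real ^ 2" where
  "centroid V = (\<Sum>v\<in>V. v) /\<^sub>R real (card V)"

definition rotation_about :: "real ^ 2 \<Rightarrow> real ^ 2 ^ 2 \<Rightarrow> real ^ 2 \<Rightarrow> real ^ 2" where
  "rotation_about c Q x = c + Q *v (x - c)"

lemma rotation_fixes_centroid:
  assumes "finite V" "V \<noteq> {}" and V: "rotation_about c Q ` V = V"
    and Q: "rotation_matrix Q"
  shows "rotation_about c Q (centroid V) = centroid V"
proof -
  let ?R = "rotation_about c Q" and ?n = "real (card V)"
  have n: "?n > 0" using assms by (simp add: card_gt_0_iff)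
  have inj: "inj_on ?R V"
    using V assms(1) by (simp add: eq_card_imp_inj_on)
  have "(\<Sum>v\<in>V. v) = (\<Sum>v\<in>?R ` V. v)" by (simp only: V)
  also have "\<dots> = (\<Sum>v\<in>V. ?R v)" using inj by (simp add: sum.reindex)
  also have "\<dots> = ?n *\<^sub>R c + Q *v ((\<Sum>v\<in>V. v) - ?n *\<^sub>R c)"
    by (simp add: rotation_about_def sum.distrib matrix_vector_mult_diff_distrib
        sum_subtractf matrix_vector_mult_scaleR sum_constant_scaleR
        del: sum_constant add: linear_sum[OF matrix_vector_mul_linear])
  finally have "(\<Sum>v\<in>V. v) /\<^sub>R ?n
      = (?n *\<^sub>R c + Q *v ((\<Sum>v\<in>V. v) - ?n *\<^sub>R c)) /\<^sub>R ?n"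
    by (rule arg_cong)
  also have "\<dots> = c + Q *v ((\<Sum>v\<in>V. v) /\<^sub>R ?n - c)"
    using n by (simp add: scaleR_add_right matrix_vector_mult_diff_distrib
        matrix_vector_mult_scaleR scaleR_diff_right)
  finally show ?thesis by (simp add: centroid_def rotation_about_def)
qed

text \<open>The barycenter of \<open>K\<close> is the centre of the regular polygon spanned by the essential
  fixed points, i.e. their centroid. By the preceding lemma no other point is the centre
  of a non-identity rotation of the plane mapping this finite set onto itself.\<close>

definition vertex_rotations ::
  "real \<Rightarrow> nat \<Rightarrow> (nat \<Rightarrow> real ^ 2) \<Rightarrow> (real ^ 2 \<Rightarrow> real ^ 2) set" where
  "vertex_rotations L N \<nu> =
     {R. (\<exists>Q. rotation_matrix Q \<and>
              R = rotation_about (centroid (essential_fixed_points L N \<nu>)) Q) \<and>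
         R ` essential_fixed_points L N \<nu> = essential_fixed_points L N \<nu>}"

text \<open>\<open>A\<close> is the set of labels, meant to have as many elements as there are essential
  fixed points.\<close>

definition good_labelling_property ::
  "real \<Rightarrow> nat \<Rightarrow> (nat \<Rightarrow> real ^ 2) \<Rightarrow> (real ^ 2) set \<Rightarrow> 'l set \<Rightarrow> bool" where
  "good_labelling_property L N \<nu> K A \<longleftrightarrow>
     (\<exists>l. l \<in> all_vertices L N \<nu> K \<rightarrow> A \<and>
          bij_betw l (essential_fixed_points L N \<nu>) A \<and>
          (\<forall>t \<in> zero_complex_shifts L N \<nu> K. \<exists>R \<in> vertex_rotations L N \<nu>.
             \<forall>v \<in> complex_vertices L N \<nu> t. l v = l (R (v - t))))"

end

theory Submission
  imports Defs
begin

text \<open>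
  Composing the reflections in the perpendicular bisectors shows that the essential fixed points
  form a regular polygon with \<open>k\<close> vertices; for even \<open>k\<close> it is symmetric about its centre \<open>c\<close>.
  By nesting, two distinct cells can only meet at vertices that are opposite to each other in the
  two cells, so the translation vectors of two 0-complexes sharing a vertex differ by \<open>2 (p - c)\<close>
  for some vertex \<open>p\<close>. For \<open>k = 2\<^sup>n\<close> an integer relation between the vectors \<open>p - c\<close> has an
  even coefficient sum, because \<open>f \<omega> = 0\<close> forces \<open>f 1\<close> to be even for a \<open>2\<^sup>n\<close>-th primitive root of
  unity \<open>\<omega>\<close> and an integer polynomial \<open>f\<close>: writing \<open>f x = g (x\<^sup>2) + x h (x\<^sup>2)\<close>, the polynomial
  \<open>g\<^sup>2 - y h\<^sup>2\<close> vanishes at \<open>y = \<omega>\<^sup>2\<close> and has at \<open>1\<close> the same parity as \<open>f\<close>. Hence every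
  translation vector can be given a parity that changes between neighbouring 0-complexes, and turning
  the labels of the odd 0-complexes by \<open>\<pi>\<close> gives a good labelling.
\<close>

section \<open>Affine maps\<close>

text \<open>The linear part of \<open>bisector_reflection x y\<close> for
  \<open>u = y - x\<close>.\<close>

definition linear_reflection :: "real ^ 2 \<Rightarrow> real ^ 2 \<Rightarrow> real ^ 2" where
  "linear_reflection u z = z - (2 * (z \<bullet> u) / (u \<bullet> u)) *\<^sub>R u"

lemma linear_linear_reflection: "linear (linear_reflection u)"
  by (rule linearI)
    (simp_all add: linear_reflection_def inner_add_left add_divide_distrib distrib_left
      scaleR_add_left scaleR_diff_right add_diff_add)

lemma bisector_reflection_add:
  "bisector_reflection x y (z + w) = bisector_reflection x y z + linear_reflection (y - x) w"
proof -
  have "2 * ((z + w - midpoint x y) \<bullet> (y - x)) = 2 * ((z - midpoint x y) \<bullet> (y - x)) + 2 * (w \<bullet> (y - x))"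
    by (simp add: inner_add_left inner_diff_left)
  then show ?thesis
    by (simp add: bisector_reflection_def linear_reflection_def add_divide_distrib scaleR_add_left)
qed

lemma bisector_reflection_involution:
  assumes "x \<noteq> y"
  shows "bisector_reflection x y (bisector_reflection x y z) = z"
proof -
  define u where "u = y - x"
  define s where "s = 2 * ((z - midpoint x y) \<bullet> u) / (u \<bullet> u)"
  have u: "u \<bullet> u \<noteq> 0" using assms by (simp add: u_def)
  have "(z - s *\<^sub>R u - midpoint x y) \<bullet> u = (z - midpoint x y) \<bullet> u - s * (u \<bullet> u)"
    by (simp add: inner_diff_left)
  also have "\<dots> = - ((z - midpoint x y) \<bullet> u)"
    using u by (simp add: s_def)
  finally have "2 * ((z - s *\<^sub>R u - midpoint x y) \<bullet> u) / (u \<bullet> u) = - s"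
    by (simp add: s_def)
  then show ?thesis
    by (simp add: bisector_reflection_def flip: u_def s_def)
qed

text \<open>With \<open>a = x - z\<close> and \<open>b = y - z\<close> the left side is minus half
  of \<open>(a + b) \<bullet> (b - a)\<close>. This turns membership in the bisector into equality
  of distances.\<close>

lemma inner_midpoint_bisector:
  fixes x y z :: "real ^ 2"
  shows "(z - midpoint x y) \<bullet> (y - x) = ((x - z) \<bullet> (x - z) - (y - z) \<bullet> (y - z)) / 2"
proof -
  define a b where "a = x - z" and "b = y - z"
  have "z - midpoint x y = - (1/2) *\<^sub>R (a + b)" "y - x = b - a"
    by (simp_all add: a_def b_def midpoint_def scaleR_add_right scaleR_diff_right flip: scaleR_add_left)
  then have "(z - midpoint x y) \<bullet> (y - x) = - (1/2) * ((a + b) \<bullet> (b - a))"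
    by (simp del: minus_mult_minus)
  also have "(a + b) \<bullet> (b - a) = b \<bullet> b - a \<bullet> a"
    by (simp add: inner_diff_right inner_add_left inner_commute[of b a])
  finally show ?thesis
    unfolding a_def b_def by argo
qed

lemma bisector_reflection_fixed_iff:
  assumes "x \<noteq> y"
  shows "bisector_reflection x y z = z \<longleftrightarrow> dist x z = dist y z"
proof -
  have "bisector_reflection x y z = z \<longleftrightarrow> (z - midpoint x y) \<bullet> (y - x) = 0"
    using assms by (simp add: bisector_reflection_def)
  also have "\<dots> \<longleftrightarrow> dist x z = dist y z"
    by (simp add: inner_midpoint_bisector dist_norm norm_eq_sqrt_inner)
  finally show ?thesis .
qed

lemma bisector_reflection_left: "x \<noteq> y \<Longrightarrow> bisector_reflection x y x = y"
  by (simp add: bisector_reflection_def inner_midpoint_bisector)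

lemma centroid_affine_image:
  assumes "finite X" "X \<noteq> {}" "inj_on f X" "linear h" and f: "\<And>z w. f (z + w) = f z + h w"
  shows "centroid (f ` X) = f (centroid X)"
proof -
  have f0: "f z = h z + f 0" for z using f[of 0 z] by simp
  have n: "real (card X) > 0" using assms by (simp add: card_gt_0_iff)
  have "(\<Sum>v\<in>f ` X. v) = (\<Sum>v\<in>X. h v + f 0)"
    using assms(3) by (simp add: sum.reindex flip: f0)
  also have "\<dots> = h (\<Sum>v\<in>X. v) + real (card X) *\<^sub>R f 0"
    by (simp add: sum.distrib linear_sum[OF assms(4)] sum_constant_scaleR del: sum_constant)
  finally have "centroid (f ` X) = h (centroid X) + f 0"
    using n assms(3) by (simp add: centroid_def card_image scaleR_add_right linear_cmul[OF assms(4)])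
  with f0[of "centroid X"] show ?thesis by simp
qed

text \<open>Strict convexity of the ball: with \<open>d = b - a\<close>, equal norms give
  \<open>2 * (a \<bullet> d) = - (d \<bullet> d)\<close>, so the squared norm drops by
  \<open>s * (1 - s) * (d \<bullet> d)\<close>.\<close>

lemma chord_interior_in_ball:
  fixes a b :: "'a::real_inner"
  assumes "norm a = norm b" "a \<noteq> b" "0 < s" "s < 1"
  shows "norm (a + s *\<^sub>R (b - a)) < norm a"
proof -
  define d where "d = b - a"
  have "(a + d) \<bullet> (a + d) = a \<bullet> a" using assms(1) by (simp add: d_def norm_eq_sqrt_inner)
  then have "2 * (a \<bullet> d) = - (d \<bullet> d)"
    by (simp add: inner_add_left inner_add_right inner_commute)
  moreover have "(a + s *\<^sub>R d) \<bullet> (a + s *\<^sub>R d) = a \<bullet> a + s * (2 * (a \<bullet> d)) + s * s * (d \<bullet> d)"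
    by (simp add: inner_add_left inner_add_right inner_commute)
  ultimately have "(a + s *\<^sub>R d) \<bullet> (a + s *\<^sub>R d) = a \<bullet> a - (s * (1 - s)) * (d \<bullet> d)"
    by (simp add: algebra_simps)
  moreover have "d \<bullet> d > 0" using assms(2) by (simp add: d_def)
  then have "(s * (1 - s)) * (d \<bullet> d) > 0" using assms(3,4) by (intro mult_pos_pos) auto
  ultimately have "(a + s *\<^sub>R d) \<bullet> (a + s *\<^sub>R d) < a \<bullet> a" by simp
  then show ?thesis by (simp add: norm_eq_sqrt_inner d_def)
qed

section \<open>Regular polygons\<close>

text \<open>\<open>Q\<close> turns out to be closed under multiplication, so multiplying by
  \<open>z\<close> permutes it. Comparing the products over \<open>Q\<close> gives
  \<open>z ^ card Q = 1\<close>, and counting gives equality.\<close>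

lemma roots_of_unity_eqI:
  fixes Q :: "complex set"
  assumes "finite Q" "1 \<in> Q" "card Q \<ge> 3"
    and nonzero: "0 \<notin> Q"
    and closed: "\<And>x y z. x \<in> Q \<Longrightarrow> y \<in> Q \<Longrightarrow> z \<in> Q \<Longrightarrow> x \<noteq> y \<Longrightarrow> x * y / z \<in> Q"
  shows "Q = {z. z ^ card Q = 1}"
proof -
  have distinct_mult: "x * y \<in> Q" if "x \<in> Q" "y \<in> Q" "x \<noteq> y" for x y
    using closed[OF that(1,2) \<open>1 \<in> Q\<close> that(3)] by simp
  have square: "x * x \<in> Q" if "x \<in> Q" for x
  proof -
    have "card {1, x} \<le> 2" by (simp add: card_insert_if)
    then have "\<not> Q \<subseteq> {1, x}"
      using assms(3) card_mono[of "{1, x}" Q] by fastforce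
    \<comment> \<open>\<open>closed\<close> excludes equal factors, so \<open>x * x\<close> is
      reached as \<open>(x * y) * x / y\<close> through a third element.\<close>
    then obtain y where y: "y \<in> Q" "y \<noteq> 1" "y \<noteq> x" by blast
    have "x * y \<in> Q" using distinct_mult[OF that y(1)] y(3) by simp
    moreover have "x * y \<noteq> x" using y(2) that nonzero by auto
    ultimately have "x * y * x / y \<in> Q" using that y(1) by (intro closed)
    moreover have "x * y * x / y = x * x" using y(1) nonzero by auto
    ultimately show ?thesis by simp
  qed
  have "z ^ card Q = 1" if "z \<in> Q" for z
  proof -
    have "(*) z ` Q \<subseteq> Q" using distinct_mult square that by auto
    moreover have inj: "inj_on ((*) z) Q" using that nonzero by (auto simp: inj_on_def)
    ultimately have "(*) z ` Q = Q"
      using assms(1) by (simp add: card_image card_subset_eq)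
    then have "\<Prod>Q = (\<Prod>x\<in>Q. z * x)"
      using prod.reindex[OF inj, of "\<lambda>x. x"] by simp
    also have "\<dots> = z ^ card Q * \<Prod>Q" by (simp add: prod.distrib)
    finally show ?thesis using nonzero assms(1) by simp
  qed
  moreover have "card {z::complex. z ^ card Q = 1} = card Q"
    using assms(3) by (intro card_roots_unity_eq) simp
  moreover have "finite {z::complex. z ^ card Q = 1}"
    using assms(3) by (intro finite_roots_unity) simp
  ultimately show ?thesis
    by (intro card_subset_eq) auto
qed

section \<open>The plane as the complex numbers\<close>

definition complex_of_vec :: "real ^ 2 \<Rightarrow> complex" where
  "complex_of_vec v = Complex (v $ 1) (v $ 2)"

lemma linear_complex_of_vec: "linear complex_of_vec"
  by (rule linearI) (simp_all add: complex_of_vec_def complex_eq_iff)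

lemma complex_of_vec_eq_iff: "complex_of_vec v = complex_of_vec w \<longleftrightarrow> v = w"
  by (simp add: complex_of_vec_def complex_eq_iff vec_eq_iff forall_2)

lemma norm_complex_of_vec: "norm (complex_of_vec v) = norm v"
  by (simp add: complex_of_vec_def cmod_def norm_vec_def L2_set_def sum_2)

text \<open>A reflection in a line through 0 is conjugation followed by a unimodular factor. On the
  circle of radius \<open>r\<close>, conjugation is \<open>r^2 / z\<close>, and the image of
  \<open>x\<close> being \<open>y\<close> makes the factor \<open>x * y / r^2\<close>.\<close>

lemma complex_of_vec_linear_reflection:
  assumes "norm x = norm y" "x \<noteq> y" "norm z = norm x"
  shows "complex_of_vec (linear_reflection (y - x) z)
    = complex_of_vec x * complex_of_vec y / complex_of_vec z"
proof (cases "z = 0")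
  case True
  then show ?thesis by (simp add: linear_reflection_def linear_0[OF linear_complex_of_vec])
next
  case False
  define a b d e p q where c: "a = x $ 1" "b = x $ 2" "d = y $ 1" "e = y $ 2" "p = z $ 1" "q = z $ 2"
  have "norm v = norm w \<longleftrightarrow> v $ 1 ^ 2 + v $ 2 ^ 2 = w $ 1 ^ 2 + w $ 2 ^ 2" for v w :: "real ^ 2"
    by (simp add: norm_vec_def L2_set_def sum_2)
  then have eqs: "a ^ 2 + b ^ 2 = d ^ 2 + e ^ 2" "p ^ 2 + q ^ 2 = a ^ 2 + b ^ 2"
    using assms by (simp_all add: c)
  \<comment> \<open>The squared length of \<open>y - x\<close>; multiplying by it clears the
    denominator of \<open>s\<close>, leaving polynomial identities.\<close>
  define D where "D = (d - a)\<^sup>2 + (e - b)\<^sup>2"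
  have D: "D \<noteq> 0"
    using assms(2) by (auto simp: D_def c sum_power2_eq_zero_iff vec_eq_iff forall_2)
  define s where "s = 2 * (p * (d - a) + q * (e - b)) / D"
  have sD: "s * D = 2 * (p * (d - a) + q * (e - b))" using D by (simp add: s_def)
  have inner: "v \<bullet> w = v $ 1 * w $ 1 + v $ 2 * w $ 2" for v w :: "real ^ 2"
    by (simp add: inner_vec_def sum_2)
  have s: "s = 2 * (z \<bullet> (y - x)) / ((y - x) \<bullet> (y - x))"
    by (simp add: s_def D_def inner c power2_eq_square)
  have "D * ((p - s * (d - a)) * p - (q - s * (e - b)) * q) = D * (a * d - b * e)"
    using eqs sD unfolding D_def by algebra
  moreover have "D * ((p - s * (d - a)) * q + (q - s * (e - b)) * p) = D * (a * e + b * d)"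
    using eqs sD unfolding D_def by algebra
  ultimately have "complex_of_vec (linear_reflection (y - x) z) * complex_of_vec z
     = complex_of_vec x * complex_of_vec y"
    using D by (simp add: linear_reflection_def complex_of_vec_def complex_eq_iff c flip: s)
  moreover have "complex_of_vec z \<noteq> 0"
    using False norm_complex_of_vec[of z] by auto
  ultimately show ?thesis by (simp add: field_simps)
qed

text \<open>Dividing by one of its points turns such a set into a subset of the unit circle that is
  closed under \<open>(x, y, z) \<mapsto> x y / z\<close> for \<open>x \<noteq> y\<close>.\<close>

lemma reflection_closed_set_is_regular_polygon:
  fixes W :: "(real ^ 2) set"
  assumes W: "finite W" "card W \<ge> 3" "w0 \<in> W"
    and norm: "\<And>w. w \<in> W \<Longrightarrow> norm w = r"
    and closed: "\<And>x y z. x \<in> W \<Longrightarrow> y \<in> W \<Longrightarrow> z \<in> W \<Longrightarrow> x \<noteq> y \<Longrightarrow> linear_reflection (y - x) z \<in> W"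
  shows "complex_of_vec ` W = (\<lambda>q. complex_of_vec w0 * q) ` {q. q ^ card W = 1}"
    and "w0 \<noteq> 0"
proof -
  let ?z = complex_of_vec
  have nz: "w \<noteq> 0" if "w \<in> W" for w
  proof
    assume "w = 0"
    with norm that have "r = 0" by force
    with norm have "W \<subseteq> {0}" by auto
    then show False using W(2) card_mono[of "{0}" W] by simp
  qed
  then show "w0 \<noteq> 0" using W by simp
  have nz': "?z w \<noteq> 0" if "w \<in> W" for w
    using nz[OF that] norm_complex_of_vec[of w] by auto
  define Q where "Q = (\<lambda>w. ?z w / ?z w0) ` W"
  have inj: "inj_on (\<lambda>w. ?z w / ?z w0) W"
    using nz'[OF W(3)] by (auto simp: inj_on_def complex_of_vec_eq_iff)
  have card: "card Q = card W" unfolding Q_def by (rule card_image[OF inj])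
  have "Q = {q. q ^ card Q = 1}"
  proof (rule roots_of_unity_eqI)
    show "finite Q" using W by (simp add: Q_def)
    show "card Q \<ge> 3" using W card by simp
    show "1 \<in> Q" using W(3) nz'[OF W(3)] by (auto simp: Q_def image_iff intro!: bexI[of _ w0])
    show "0 \<notin> Q" using nz' W(3) by (auto simp: Q_def)
    fix x y z assume "x \<in> Q" "y \<in> Q" "z \<in> Q" "x \<noteq> y"
    then obtain a b c where *: "a \<in> W" "b \<in> W" "c \<in> W" "a \<noteq> b"
      "x = ?z a / ?z w0" "y = ?z b / ?z w0" "z = ?z c / ?z w0"
      by (auto simp: Q_def)
    have "?z (linear_reflection (b - a) c) = ?z a * ?z b / ?z c"
      using norm * by (intro complex_of_vec_linear_reflection) auto
    moreover have "x * y / z = (?z a * ?z b / ?z c) / ?z w0"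
      unfolding *(5-7) using nz'[OF *(3)] nz'[OF W(3)] by (simp add: field_simps)
    ultimately have "x * y / z = ?z (linear_reflection (b - a) c) / ?z w0"
      by simp
    then show "x * y / z \<in> Q" using closed[OF *(1-4)] by (auto simp: Q_def)
  qed
  then have Q: "Q = {q. q ^ card W = 1}" using card by simp
  have "?z ` W = (\<lambda>q. ?z w0 * q) ` Q"
    using nz'[OF W(3)] by (simp add: Q_def image_image)
  then show "?z ` W = (\<lambda>q. ?z w0 * q) ` {q. q ^ card W = 1}"
    unfolding Q .
qed

section \<open>Integer relations between roots of unity\<close>

text \<open>The pairs \<open>(f \<omega>, f 1)\<close> for integer polynomials \<open>f\<close>.\<close>

inductive_set int_values :: "complex \<Rightarrow> (complex \<times> int) set" for \<omega> where
  int_values_of_int: "(of_int m, m) \<in> int_values \<omega>"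
| int_values_root: "(\<omega>, 1) \<in> int_values \<omega>"
| int_values_add: "(x, a) \<in> int_values \<omega> \<Longrightarrow> (y, b) \<in> int_values \<omega> \<Longrightarrow> (x + y, a + b) \<in> int_values \<omega>"
| int_values_mult: "(x, a) \<in> int_values \<omega> \<Longrightarrow> (y, b) \<in> int_values \<omega> \<Longrightarrow> (x * y, a * b) \<in> int_values \<omega>"

lemma int_values_power: "(\<omega> ^ j, 1) \<in> int_values \<omega>"
proof (induction j)
  case 0
  show ?case using int_values_of_int[of 1 \<omega>] by simp
next
  case (Suc j)
  then show ?case using int_values_mult[OF int_values_root Suc] by simp
qed

lemma int_values_sum:
  assumes "finite X"
  shows "((\<Sum>x\<in>X. of_int (m x) * \<omega> ^ e x), (\<Sum>x\<in>X. m x)) \<in> int_values \<omega>"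
  using assms
proof (induction X)
  case empty
  show ?case using int_values_of_int[of 0 \<omega>] by simp
next
  case (insert x X)
  then show ?case
    using int_values_add[OF int_values_mult[OF int_values_of_int[of "m x"] int_values_power[of \<omega> "e x"]]]
    by simp
qed

text \<open>The split of a polynomial into even and odd powers, by induction on the generation of
  the pair, since the pair does not record coefficients.\<close>

lemma int_values_even_odd_parts:
  assumes "(x, a) \<in> int_values \<omega>"
  obtains g b h d where "(g, b) \<in> int_values (\<omega>\<^sup>2)" "(h, d) \<in> int_values (\<omega>\<^sup>2)"
    "x = g + \<omega> * h" "a = b + d"
proof -
  have "\<exists>g b h d. (g, b) \<in> int_values (\<omega>\<^sup>2) \<and> (h, d) \<in> int_values (\<omega>\<^sup>2) \<and> x = g + \<omega> * h \<and> a = b + d"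
    using assms
  proof induction
    case (int_values_of_int m)
    show ?case
      using int_values.int_values_of_int[of m "\<omega>\<^sup>2"] int_values.int_values_of_int[of 0 "\<omega>\<^sup>2"]
      by (intro exI[of _ "of_int m"] exI[of _ m] exI[of _ 0]) simp
  next
    case int_values_root
    show ?case
      using int_values.int_values_of_int[of 1 "\<omega>\<^sup>2"] int_values.int_values_of_int[of 0 "\<omega>\<^sup>2"]
      by (intro exI[of _ 0] exI[of _ 1]) simp
  next
    case (int_values_add x a y b)
    then obtain g p h q g' p' h' q' where
      *: "(g, p) \<in> int_values (\<omega>\<^sup>2)" "(h, q) \<in> int_values (\<omega>\<^sup>2)" "x = g + \<omega> * h" "a = p + q"
       "(g', p') \<in> int_values (\<omega>\<^sup>2)" "(h', q') \<in> int_values (\<omega>\<^sup>2)" "y = g' + \<omega> * h'" "b = p' + q'"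
      by blast
    show ?case
      using int_values.int_values_add[OF *(1,5)] int_values.int_values_add[OF *(2,6)] *(3,4,7,8)
      by (intro exI[of _ "g + g'"] exI[of _ "p + p'"] exI[of _ "h + h'"] exI[of _ "q + q'"])
        (simp add: algebra_simps)
  next
    case (int_values_mult x a y b)
    then obtain g p h q g' p' h' q' where
      *: "(g, p) \<in> int_values (\<omega>\<^sup>2)" "(h, q) \<in> int_values (\<omega>\<^sup>2)" "x = g + \<omega> * h" "a = p + q"
       "(g', p') \<in> int_values (\<omega>\<^sup>2)" "(h', q') \<in> int_values (\<omega>\<^sup>2)" "y = g' + \<omega> * h'" "b = p' + q'"
      by blast
    note m = int_values.int_values_mult and a = int_values.int_values_add
    \<comment> \<open>The even part of \<open>(g + \<omega> * h) * (g' + \<omega> * h')\<close>; the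
      extra factor is the root of the new system, with second component 1.\<close>
    have "(g * g' + \<omega>\<^sup>2 * (h * h'), p * p' + 1 * (q * q')) \<in> int_values (\<omega>\<^sup>2)"
      by (intro m a * int_values.int_values_root)
    moreover have "(g * h' + h * g', p * q' + q * p') \<in> int_values (\<omega>\<^sup>2)"
      by (intro m a *)
    ultimately show ?case using *(3,4,7,8)
      by (intro exI[of _ "g * g' + \<omega>\<^sup>2 * (h * h')"] exI[of _ "p * p' + 1 * (q * q')"]
          exI[of _ "g * h' + h * g'"] exI[of _ "p * q' + q * p'"])
        (simp add: algebra_simps power2_eq_square)
  qed
  with that show thesis by blast
qed

lemma int_values_zero_even:
  assumes "\<omega> ^ (2 ^ m) = -1" "(0, a) \<in> int_values \<omega>"
  shows "even a"
  using assms
proof (induction m arbitrary: \<omega> a)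
  case 0
  then have \<omega>: "\<omega> = -1" by simp
  \<comment> \<open>An integer polynomial has values of equal parity at -1 and at 1.\<close>
  have "\<exists>b. x = of_int b \<and> even (a - b)" if "(x, a) \<in> int_values \<omega>" for x a
    using that
  proof induction
    case (int_values_of_int m)
    then show ?case by auto
  next
    case int_values_root
    then show ?case using \<omega> by (intro exI[of _ "-1"]) simp
  next
    case (int_values_add x a y b)
    then obtain a' b' where "x = of_int a'" "y = of_int b'" "even (a - a')" "even (b - b')" by blast
    then show ?case by (intro exI[of _ "a' + b'"]) auto
  next
    case (int_values_mult x a y b)
    then obtain a' b' where "x = of_int a'" "y = of_int b'" "even (a - a')" "even (b - b')" by blast
    then show ?case by (intro exI[of _ "a' * b'"]) auto
  qed
  from this[OF 0(2)] show ?case by auto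
next
  case (Suc m)
  obtain g b h d where gh: "(g, b) \<in> int_values (\<omega>\<^sup>2)" "(h, d) \<in> int_values (\<omega>\<^sup>2)"
    "0 = g + \<omega> * h" "a = b + d"
    using Suc.prems(2) by (rule int_values_even_odd_parts)
  have "(g * g + of_int (-1) * (\<omega>\<^sup>2 * (h * h)), b * b + (-1) * (1 * (d * d))) \<in> int_values (\<omega>\<^sup>2)"
    by (intro int_values_add int_values_mult gh int_values_of_int int_values_root)
  moreover have "g = - (\<omega> * h)" using gh(3) by (simp add: eq_neg_iff_add_eq_0)
  ultimately have "(0, b * b - d * d) \<in> int_values (\<omega>\<^sup>2)"
    by (simp add: power2_eq_square algebra_simps)
  moreover have "(\<omega>\<^sup>2) ^ (2 ^ m) = -1"
    using Suc.prems(1) by (simp add: power_mult[symmetric])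
  ultimately have "even (b * b - d * d)" using Suc.IH by blast
  then show ?case using gh(4) by auto
qed

text \<open>The integer combinations of \<open>B\<close> form a group. A representative is chosen in
  each coset, and a vector is coloured by the parity of the coefficient sum of its difference from
  the representative; \<open>even\<close> makes this independent of the coefficients.\<close>

lemma exists_alternating_colouring:
  fixes B :: "'a::real_vector set"
  assumes "finite B"
    and even: "\<And>m :: 'a \<Rightarrow> int. (\<Sum>b\<in>B. of_int (m b) *\<^sub>R b) = 0 \<Longrightarrow> even (\<Sum>b\<in>B. m b)"
  obtains \<phi> :: "'a \<Rightarrow> bool" where "\<And>t b. b \<in> B \<Longrightarrow> \<phi> (t + b) \<longleftrightarrow> \<not> \<phi> t"
proof -
  define comb :: "('a \<Rightarrow> int) \<Rightarrow> 'a" where "comb m = (\<Sum>b\<in>B. of_int (m b) *\<^sub>R b)" for m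
  define rep where "rep t = (SOME s. \<exists>m. t = s + comb m)" for t
  define \<phi> where "\<phi> t \<longleftrightarrow> (\<exists>m. t = rep t + comb m \<and> odd (\<Sum>b\<in>B. m b))" for t
  have comb_add: "comb (\<lambda>b. m b + m' b) = comb m + comb m'" for m m'
    by (simp add: comb_def scaleR_add_left sum.distrib)
  have comb_diff: "comb (\<lambda>b. m b - m' b) = comb m - comb m'" for m m'
    by (simp add: comb_def scaleR_diff_left sum_subtractf)
  have comb_single: "comb (\<lambda>b'. if b' = b then 1 else 0) = b" if "b \<in> B" for b
  proof -
    have "comb (\<lambda>b'. if b' = b then 1 else 0) = (\<Sum>b'\<in>B. if b' = b then b' else 0)"
      unfolding comb_def by (rule sum.cong) auto
    with that assms(1) show ?thesis by simp
  qed
  have single: "(\<Sum>b'\<in>B. if b' = b then 1 else 0 :: int) = 1" if "b \<in> B" for b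
    using that assms(1) by simp
  have rep: "\<exists>m. t = rep t + comb m" for t
    unfolding rep_def by (rule someI[of _ t]) (auto intro!: exI[of _ "\<lambda>_. 0"] simp: comb_def)
  have \<phi>: "\<phi> t \<longleftrightarrow> odd (\<Sum>b\<in>B. m b)" if "t = rep t + comb m" for t m
  proof -
    have "even (\<Sum>b\<in>B. m b) \<longleftrightarrow> even (\<Sum>b\<in>B. m' b)" if "t = rep t + comb m'" for m'
    proof -
      have "comb (\<lambda>b. m b - m' b) = 0"
        using that \<open>t = rep t + comb m\<close> by (metis comb_diff add_left_cancel diff_self)
      then have "even (\<Sum>b\<in>B. m b - m' b)" by (intro even) (simp add: comb_def)
      then show ?thesis by (simp add: sum_subtractf)
    qed
    with that show ?thesis unfolding \<phi>_def by blast
  qed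
  have "\<phi> (t + b) \<longleftrightarrow> \<not> \<phi> t" if "b \<in> B" for t b
  proof -
    let ?e = "\<lambda>b'. if b' = b then 1 else 0 :: int"
    \<comment> \<open>\<open>t\<close> and \<open>t + b\<close> lie in the same coset, so the choice
      operator receives the same predicate and returns the same representative.\<close>
    have "(\<exists>m. t + b = s + comb m) \<longleftrightarrow> (\<exists>m. t = s + comb m)" for s
    proof
      assume "\<exists>m. t + b = s + comb m"
      then obtain m where "t + b = s + comb m" ..
      then have "t = s + comb (\<lambda>b. m b - ?e b)"
        using comb_single[OF that] by (simp add: comb_diff algebra_simps)
      then show "\<exists>m. t = s + comb m" by blast
    next
      assume "\<exists>m. t = s + comb m"
      then obtain m where "t = s + comb m" ..
      then have "t + b = s + comb (\<lambda>b. m b + ?e b)"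
        using comb_single[OF that] by (simp add: comb_add algebra_simps)
      then show "\<exists>m. t + b = s + comb m" by blast
    qed
    then have same: "rep (t + b) = rep t" by (simp add: rep_def)
    obtain m where m: "t = rep t + comb m" using rep by blast
    then have "t + b = rep (t + b) + comb (\<lambda>b. m b + ?e b)"
      using comb_single[OF that] same by (simp add: comb_add algebra_simps)
    from \<phi>[OF this] \<phi>[OF m] show ?thesis
      using single[OF that] by (simp add: sum.distrib)
  qed
  with that show thesis .
qed

section \<open>Nested fractals with an even number of essential fixed points\<close>

text \<open>Evenness supplies antipodal vertices; the power of two is brought in by
  \<open>exists_parity\<close>.\<close>

locale even_nested_fractal =
  fixes L :: real and N :: nat and \<nu> :: "nat \<Rightarrow> real ^ 2" and K :: "(real ^ 2) set"
  assumes snf: "simple_nested_fractal L N \<nu> K"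
    and card_ge: "card (essential_fixed_points L N \<nu>) \<ge> 3"
    and card_even: "even (card (essential_fixed_points L N \<nu>))"
begin

abbreviation "V \<equiv> essential_fixed_points L N \<nu>"
abbreviation "c \<equiv> centroid V"
abbreviation "\<Psi> \<equiv> sim L \<nu>"

section \<open>First consequences of the axioms; the attractor\<close>

lemma L: "L > 1"
  and attractor: "K = (\<Union>i\<in>{1..N}. \<Psi> i ` K)" "compact K" "K \<noteq> {}"
  and nested: "i \<in> {1..N} \<Longrightarrow> j \<in> {1..N} \<Longrightarrow> i \<noteq> j \<Longrightarrow> \<Psi> i ` K \<inter> \<Psi> j ` K = \<Psi> i ` V \<inter> \<Psi> j ` V"
  using snf by (simp_all add: simple_nested_fractal_def is_attractor_def nesting_def)

lemma finite_V: "finite V" and V_nonempty: "V \<noteq> {}"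
  using card_ge by (auto intro: card_ge_0_finite)

lemma sim_eq_iff: "\<Psi> i x = \<Psi> i y \<longleftrightarrow> x = y"
  using L by (simp add: sim_def)

lemma sim_image_iff: "\<Psi> i x \<in> \<Psi> i ` X \<longleftrightarrow> x \<in> X"
  by (auto simp: sim_eq_iff)

lemma sim_add: "\<Psi> i (x + y) = \<Psi> i x + y /\<^sub>R L"
  by (simp add: sim_def scaleR_add_right)

lemma sim_in_attractor: "i \<in> {1..N} \<Longrightarrow> x \<in> K \<Longrightarrow> \<Psi> i x \<in> K"
  using attractor(1) by blast

lemma attractor_cell:
  assumes "x \<in> K"
  obtains i y where "i \<in> {1..N}" "y \<in> K" "x = \<Psi> i y"
  using assms by (subst (asm) attractor(1)) blast

lemma exists_open_set:
  obtains U where "U \<noteq> {}" "\<And>i j. i \<in> {1..N} \<Longrightarrow> j \<in> {1..N} \<Longrightarrow> i \<noteq> j \<Longrightarrow> \<Psi> i ` U \<inter> \<Psi> j ` U = {}"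
    "\<And>i. i \<in> {1..N} \<Longrightarrow> \<Psi> i ` U \<subseteq> U"
proof -
  obtain U where "U \<noteq> {}" "\<forall>i\<in>{1..N}. \<forall>j\<in>{1..N}. i \<noteq> j \<longrightarrow> \<Psi> i ` U \<inter> \<Psi> j ` U = {}"
    "(\<Union>i\<in>{1..N}. \<Psi> i ` U) \<subseteq> U"
    using snf unfolding simple_nested_fractal_def open_set_condition_def by blast
  then show thesis by (intro that[of U]) blast+
qed

text \<open>Equal maps would have equal nonempty images of the open set, which cannot be
  disjoint.\<close>

lemma translation_inj: "inj_on \<nu> {1..N}"
proof (rule inj_onI, rule ccontr)
  fix i j assume *: "i \<in> {1..N}" "j \<in> {1..N}" "\<nu> i = \<nu> j" "i \<noteq> j"
  then have "\<Psi> i = \<Psi> j" by (auto simp: sim_def)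
  with * exists_open_set show False by (metis Int_absorb image_is_empty)
qed

text \<open>A point of \<open>X\<close> farthest from \<open>K\<close> is the image of a point of
  \<open>X\<close> under some \<open>\<Psi> i\<close>, which divides distances by \<open>L\<close>;
  hence the maximal distance is 0.\<close>

lemma sub_invariant_subset_attractor:
  assumes "compact X" "X \<subseteq> (\<Union>i\<in>{1..N}. \<Psi> i ` X)"
  shows "X \<subseteq> K"
proof (cases "X = {}")
  case False
  have "continuous_on X (\<lambda>x. infdist x K)" by (intro continuous_intros)
  then obtain x where x: "x \<in> X" "\<And>y. y \<in> X \<Longrightarrow> infdist y K \<le> infdist x K"
    using continuous_attains_sup[OF assms(1) False] by blast
  obtain i y where iy: "i \<in> {1..N}" "y \<in> X" "x = \<Psi> i y" using assms(2) x(1) by blast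
  obtain k where k: "k \<in> K" "infdist y K = dist y k"
    using infdist_attains_inf[of K y] attractor(2,3) by (auto dest: compact_imp_closed)
  have "infdist x K \<le> dist (\<Psi> i y) (\<Psi> i k)"
    unfolding iy(3) by (intro infdist_le sim_in_attractor iy k)
  also have "\<dots> = dist y k / L"
    using L by (simp add: sim_def dist_norm divide_inverse flip: scaleR_diff_right)
  also have "\<dots> \<le> infdist x K / L"
    using x(2)[OF iy(2)] k L by (simp add: divide_right_mono)
  finally have "infdist x K * L \<le> infdist x K" using L by (simp add: pos_le_divide_eq)
  then have "infdist x K * (L - 1) \<le> 0" by (simp add: right_diff_distrib)
  then have "infdist x K = 0"
    using L infdist_nonneg[of x K] by (simp add: mult_le_0_iff)
  then have "infdist y K = 0" if "y \<in> X" for y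
    using x(2)[OF that] infdist_nonneg[of y K] by simp
  then show ?thesis
    using in_closed_iff_infdist_zero[of K] attractor(2,3) by (auto dest: compact_imp_closed)
qed auto

lemma vertex_cell:
  assumes "x \<in> V"
  obtains i where "i \<in> {1..N}" "\<Psi> i x = x"
  using assms by (auto simp: essential_fixed_points_def fixed_points_def)

lemma vertices_subset: "V \<subseteq> K"
proof
  fix x assume "x \<in> V"
  then obtain i where "i \<in> {1..N}" "\<Psi> i x = x" by (rule vertex_cell)
  then have "{x} \<subseteq> (\<Union>i\<in>{1..N}. \<Psi> i ` {x})" by force
  then have "{x} \<subseteq> K" by (intro sub_invariant_subset_attractor) auto
  then show "x \<in> K" by simp
qed

subsection \<open>The essential fixed points form a regular polygon\<close>

lemma centroid_sim_image: "centroid (\<Psi> i ` V) = \<Psi> i c"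
proof (rule centroid_affine_image[OF finite_V V_nonempty])
  show "inj_on (\<Psi> i) V" by (simp add: inj_on_def sim_eq_iff)
  show "linear (\<lambda>x::real^2. x /\<^sub>R L)" by (intro linearI) (simp_all add: scaleR_add_right)
  show "\<Psi> i (z + w) = \<Psi> i z + w /\<^sub>R L" for z w by (rule sim_add)
qed

lemma inj_bisector_reflection: "x \<noteq> y \<Longrightarrow> inj_on (bisector_reflection x y) X"
  by (rule inj_on_inverseI[where g = "bisector_reflection x y"])
    (simp add: bisector_reflection_involution)

lemma bisector_reflection_centroid:
  assumes "x \<noteq> y" "finite X" "X \<noteq> {}"
  shows "centroid (bisector_reflection x y ` X) = bisector_reflection x y (centroid X)"
  using assms
  by (intro centroid_affine_image[where h = "linear_reflection (y - x)"] inj_bisector_reflection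
      linear_linear_reflection bisector_reflection_add)

text \<open>Symmetry matches only vertex sets; taking centroids shows where the centre of the cell
  goes.\<close>

lemma reflected_cell:
  assumes "i \<in> {1..N}" "x \<in> V" "y \<in> V" "x \<noteq> y"
  obtains j where "j \<in> {1..N}" "bisector_reflection x y ` \<Psi> i ` V = \<Psi> j ` V"
    "bisector_reflection x y (\<Psi> i c) = \<Psi> j c"
proof -
  obtain j where j: "j \<in> {1..N}" "bisector_reflection x y ` \<Psi> i ` V = \<Psi> j ` V"
    using snf assms unfolding simple_nested_fractal_def symmetry_condition_def by blast
  have "bisector_reflection x y (\<Psi> i c) = centroid (bisector_reflection x y ` \<Psi> i ` V)"
    using finite_V V_nonempty assms
    by (subst bisector_reflection_centroid) (simp_all add: centroid_sim_image)
  with j that show thesis by (simp add: centroid_sim_image)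
qed

text \<open>Comparing a cell with its mirror image relative to their centres and undoing the
  scaling. Only the linear part appears, since the mirror is not yet known to pass through
  \<open>c\<close>.\<close>

lemma linear_reflection_vertices:
  assumes "x \<in> V" "y \<in> V" "v \<in> V" "x \<noteq> y"
  shows "c + linear_reflection (y - x) (v - c) \<in> V"
proof -
  obtain i where i: "i \<in> {1..N}" using vertex_cell[OF assms(1)] by blast
  obtain j where j: "bisector_reflection x y ` \<Psi> i ` V = \<Psi> j ` V"
    "bisector_reflection x y (\<Psi> i c) = \<Psi> j c"
    using reflected_cell[OF i assms(1,2,4)] by metis
  have "bisector_reflection x y (\<Psi> i v) = bisector_reflection x y (\<Psi> i c + (v - c) /\<^sub>R L)"
    by (simp flip: sim_add)
  also have "\<dots> = \<Psi> j c + linear_reflection (y - x) (v - c) /\<^sub>R L"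
    by (simp add: bisector_reflection_add j linear_cmul[OF linear_linear_reflection])
  also have "\<dots> = \<Psi> j (c + linear_reflection (y - x) (v - c))"
    by (simp add: sim_add)
  finally have eq: "bisector_reflection x y (\<Psi> i v) = \<Psi> j (c + linear_reflection (y - x) (v - c))" .
  have "bisector_reflection x y (\<Psi> i v) \<in> bisector_reflection x y ` \<Psi> i ` V"
    by (intro imageI assms)
  then show ?thesis unfolding j(1) eq by (simp only: sim_image_iff)
qed

text \<open>All bisectors pass through the centroid \<open>b\<close> of the centres of the cells, so the vertices
  are equidistant from \<open>b\<close>; their own centroid turns out to be equidistant as well.\<close>

lemma exists_vertex_circle: "\<exists>b r. \<forall>v\<in>V. dist v b = r"
proof -
  define C where "C = (\<lambda>i. \<Psi> i c) ` {1..N}"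
  obtain v0 where v0: "v0 \<in> V" using V_nonempty by blast
  obtain i where "i \<in> {1..N}" using vertex_cell[OF v0] by blast
  then have C: "finite C" "C \<noteq> {}" unfolding C_def by blast+
  have "dist x (centroid C) = dist y (centroid C)" if xy: "x \<in> V" "y \<in> V" "x \<noteq> y" for x y
  proof -
    have "bisector_reflection x y ` C \<subseteq> C"
      using reflected_cell[OF _ xy] by (fastforce simp: C_def)
    then have "bisector_reflection x y ` C = C"
      using C inj_bisector_reflection[OF xy(3)] by (simp add: card_image card_subset_eq)
    then have "bisector_reflection x y (centroid C) = centroid C"
      using bisector_reflection_centroid[OF xy(3) C] by simp
    then show ?thesis using bisector_reflection_fixed_iff[OF xy(3)] by simp
  qed
  then show ?thesis using v0 by (intro exI[of _ "centroid C"] exI[of _ "dist v0 (centroid C)"]) metis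
qed

lemma sum_centred: "(\<Sum>v\<in>V. v - c) = 0"
  using card_ge
  by (simp add: sum_subtractf sum_constant_scaleR centroid_def del: sum_constant)

text \<open>Let \<open>e\<close> be the offset of the circle's centre from \<open>c\<close>. Once
  \<open>(v - c) \<bullet> e\<close> is the same for all vertices, it is 0 because the sum over
  \<open>V\<close> vanishes, and the circle equation makes \<open>norm (v - c)\<close>
  constant.\<close>

lemma exists_radius: "\<exists>r. \<forall>v\<in>V. norm (v - c) = r"
proof -
  obtain b r where b: "\<And>v. v \<in> V \<Longrightarrow> dist v b = r" using exists_vertex_circle by blast
  define e where "e = b - c"
  have eq: "(w - e) \<bullet> (w - e) = r\<^sup>2" if "c + w \<in> V" for w
    using b[OF that] by (simp add: e_def dist_norm dot_square_norm algebra_simps)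
  have orth: "(x - y) \<bullet> e = 0" if xy: "x \<in> V" "y \<in> V" for x y
  proof (rule ccontr)
    assume ne: "(x - y) \<bullet> e \<noteq> 0"
    define u where "u = y - x"
    have u: "u \<bullet> e \<noteq> 0" "u \<noteq> 0" using ne by (auto simp: u_def inner_diff_left)
    \<comment> \<open>\<open>w\<close> and its reflection both satisfy the circle equation;
      subtracting leaves \<open>s * (u \<bullet> e) = 0\<close>. Applied to both ends of
      \<open>u\<close>, this makes \<open>u\<close> orthogonal to itself.\<close>
    have zero: "w \<bullet> u = 0" if "c + w \<in> V" for w
    proof -
      define s where "s = 2 * (w \<bullet> u) / (u \<bullet> u)"
      have "c + linear_reflection u (c + w - c) \<in> V"
        unfolding u_def by (intro linear_reflection_vertices) (use that xy u in \<open>auto simp: u_def\<close>)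
      then have "c + (w - s *\<^sub>R u) \<in> V" by (simp add: linear_reflection_def s_def)
      from eq[OF this] eq[OF that] have "(w - s *\<^sub>R u - e) \<bullet> (w - s *\<^sub>R u - e) = (w - e) \<bullet> (w - e)"
        by simp
      then have "s * (s * (u \<bullet> u)) - 2 * s * (w \<bullet> u) + 2 * s * (u \<bullet> e) = 0"
        by (simp add: inner_diff_left inner_diff_right inner_commute algebra_simps)
      moreover have "s * (u \<bullet> u) = 2 * (w \<bullet> u)" using u by (simp add: s_def)
      ultimately have "s * (u \<bullet> e) = 0" by simp
      then have "s = 0" using u by simp
      then show ?thesis using u by (simp add: s_def)
    qed
    have "(y - c) \<bullet> u = 0" "(x - c) \<bullet> u = 0" using zero xy by auto
    then have "u \<bullet> u = 0" by (simp add: u_def inner_diff_left)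
    then show False using u by simp
  qed
  obtain v0 where v0: "v0 \<in> V" using V_nonempty by blast
  have "(v - c) \<bullet> e = 0" if v: "v \<in> V" for v
  proof -
    have "(w - c) \<bullet> e = (v - c) \<bullet> e" if "w \<in> V" for w
      using orth[OF that v] by (simp add: inner_diff_left)
    then have "(\<Sum>w\<in>V. (w - c) \<bullet> e) = real (card V) * ((v - c) \<bullet> e)" by simp
    moreover have "(\<Sum>w\<in>V. (w - c) \<bullet> e) = 0"
      using sum_centred by (simp flip: inner_sum_left)
    ultimately show ?thesis using card_ge by simp
  qed
  moreover have "(w - e) \<bullet> (w - e) = w \<bullet> w - 2 * (w \<bullet> e) + e \<bullet> e" for w
    by (simp add: inner_diff_left inner_diff_right inner_commute)
  ultimately have "(v - c) \<bullet> (v - c) = r\<^sup>2 - e \<bullet> e" if "v \<in> V" for v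
    using eq[of "v - c"] that by force
  then show ?thesis unfolding norm_eq_sqrt_inner by metis
qed

lemma norm_vertex_eq: "x \<in> V \<Longrightarrow> y \<in> V \<Longrightarrow> norm (x - c) = norm (y - c)"
  using exists_radius by metis

lemma bisector_through_centroid:
  assumes "x \<in> V" "y \<in> V" "x \<noteq> y"
  shows "bisector_reflection x y z = c + linear_reflection (y - x) (z - c)"
proof -
  have "bisector_reflection x y c = c"
    using norm_vertex_eq[OF assms(1,2)] assms(3) by (simp add: bisector_reflection_fixed_iff dist_norm)
  then show ?thesis using bisector_reflection_add[of x y c "z - c"] by simp
qed

lemma vertices_regular_polygon:
  assumes "v0 \<in> V"
  shows "(\<lambda>v. complex_of_vec (v - c)) ` V = (\<lambda>q. complex_of_vec (v0 - c) * q) ` {q. q ^ card V = 1}"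
    and "v0 \<noteq> c"
proof -
  let ?W = "(\<lambda>v. v - c) ` V"
  have card: "card ?W = card V" by (intro card_image) (simp add: inj_on_def)
  have ref: "linear_reflection (y - x) z \<in> ?W" if "x \<in> ?W" "y \<in> ?W" "z \<in> ?W" "x \<noteq> y" for x y z
  proof -
    have "c + linear_reflection ((c + y) - (c + x)) ((c + z) - c) \<in> V"
      by (rule linear_reflection_vertices) (use that in auto)
    then show ?thesis by (simp add: image_iff) (metis add_diff_cancel_left')
  qed
  have 1: "finite ?W" "card ?W \<ge> 3" "v0 - c \<in> ?W" using finite_V card_ge card assms by auto
  have 2: "norm w = norm (v0 - c)" if "w \<in> ?W" for w
    using that norm_vertex_eq[OF _ assms] by blast
  from reflection_closed_set_is_regular_polygon(1)[OF 1 2 ref] show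
    "(\<lambda>v. complex_of_vec (v - c)) ` V = (\<lambda>q. complex_of_vec (v0 - c) * q) ` {q. q ^ card V = 1}"
    by (simp add: card image_image)
  from reflection_closed_set_is_regular_polygon(2)[OF 1 2 ref] show "v0 \<noteq> c" by simp
qed

text \<open>For even \<open>card V\<close>, -1 is one of the roots of unity.\<close>

lemma antipode_vertex:
  assumes "v \<in> V"
  shows "2 *\<^sub>R c - v \<in> V"
proof -
  have "complex_of_vec (v - c) * (-1) \<in> (\<lambda>v. complex_of_vec (v - c)) ` V"
    unfolding vertices_regular_polygon(1)[OF assms] using card_even by (intro imageI) simp
  then obtain w where w: "w \<in> V" "- complex_of_vec (v - c) = complex_of_vec (w - c)" by auto
  then have "w - c = - (v - c)"
    by (simp add: linear_neg[OF linear_complex_of_vec, symmetric] complex_of_vec_eq_iff)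
  then have "w = 2 *\<^sub>R c - v" by (simp add: scaleR_2 algebra_simps)
  with w show ?thesis by simp
qed

subsection \<open>Cells sharing a vertex\<close>

text \<open>The mirror passes through \<open>c\<close>, so reflecting cell \<open>i\<close> of
  \<open>K\<close> gives cell \<open>j\<close> of the reflected \<open>K\<close>; the reflected set
  is thus sub-invariant.\<close>

lemma bisector_reflection_attractor:
  assumes "x \<in> V" "y \<in> V" "x \<noteq> y" "z \<in> K"
  shows "bisector_reflection x y z \<in> K"
proof -
  let ?S = "bisector_reflection x y"
  have "continuous_on K ?S"
    unfolding bisector_reflection_def using assms(3) by (intro continuous_intros) auto
  then have "compact (?S ` K)" using attractor(2) by (rule compact_continuous_image)
  moreover have "?S ` K \<subseteq> (\<Union>j\<in>{1..N}. \<Psi> j ` ?S ` K)"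
  proof
    fix w assume "w \<in> ?S ` K"
    then obtain z0 where z0: "z0 \<in> K" "w = ?S z0" by blast
    obtain i z where i: "i \<in> {1..N}" "z \<in> K" "z0 = \<Psi> i z"
      using attractor_cell[OF z0(1)] .
    obtain j where j: "j \<in> {1..N}" "?S (\<Psi> i c) = \<Psi> j c"
      using reflected_cell[OF i(1) assms(1-3)] by metis
    have "w = ?S (\<Psi> i c + (z - c) /\<^sub>R L)" by (simp add: z0(2) i(3) flip: sim_add)
    also have "\<dots> = \<Psi> j c + linear_reflection (y - x) (z - c) /\<^sub>R L"
      by (simp add: bisector_reflection_add j(2) linear_cmul[OF linear_linear_reflection])
    also have "\<dots> = \<Psi> j (?S z)"
      using bisector_through_centroid[OF assms(1-3)] by (simp add: sim_add)
    finally show "w \<in> (\<Union>j\<in>{1..N}. \<Psi> j ` ?S ` K)" using j(1) i(2) by blast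
  qed
  ultimately have "?S ` K \<subseteq> K" by (rule sub_invariant_subset_attractor)
  with assms(4) show ?thesis by blast
qed

text \<open>If two distinct cells shared a vertex at non-opposite positions, they would be mirror
  images of each other and hence share every point of the first cell on the mirror axis. The point
  \<open>z\<close> below, on a chord of the vertex polygon, is such a point.\<close>

lemma shared_vertex_opposite:
  assumes ij: "i \<in> {1..N}" "j \<in> {1..N}" "i \<noteq> j"
    and xy: "x \<in> V" "y \<in> V" and eq: "\<Psi> i x = \<Psi> j y"
  shows "x + y = 2 *\<^sub>R c"
proof (rule ccontr)
  assume ne: "x + y \<noteq> 2 *\<^sub>R c"
  have "\<nu> i \<noteq> \<nu> j" using ij translation_inj by (auto dest: inj_onD)
  with eq have "x \<noteq> y" by (auto simp: sim_def)
  let ?S = "bisector_reflection x y"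
  \<comment> \<open>By Thales the chord from \<open>x\<close> to the antipode of \<open>y\<close> is
    perpendicular to \<open>y - x\<close>, so the reflection only carries it from \<open>x\<close>
    to \<open>y\<close>.\<close>
  define y' where "y' = 2 *\<^sub>R c - y"
  have y': "y' \<in> V" "y' \<noteq> x"
    using antipode_vertex[OF xy(2)] ne by (auto simp: y'_def)
  define z where "z = x + (y' - x) /\<^sub>R L"
  obtain k where k: "k \<in> {1..N}" "\<Psi> k x = x" using vertex_cell[OF xy(1)] by blast
  have "z = \<Psi> k y'" using sim_add[of k x "y' - x"] k(2) by (simp add: z_def)
  then have "z \<in> K" using sim_in_attractor[OF k(1)] y'(1) vertices_subset by blast
  have "(y' - x) \<bullet> (y - x) = (x - c) \<bullet> (x - c) - (y - c) \<bullet> (y - c)"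
    by (simp add: y'_def inner_diff_left inner_diff_right inner_commute algebra_simps)
  also have "\<dots> = 0" using norm_vertex_eq[OF xy] by (simp flip: power2_norm_eq_inner)
  finally have "?S z = ?S x + (y' - x) /\<^sub>R L"
    by (simp add: z_def bisector_reflection_add linear_reflection_def)
  then have "?S z = y + (y' - x) /\<^sub>R L"
    using bisector_reflection_left[OF \<open>x \<noteq> y\<close>] by simp
  then have "\<Psi> i z = \<Psi> j (?S z)" by (simp add: z_def sim_add eq)
  moreover have "?S z \<in> K"
    using bisector_reflection_attractor[OF xy \<open>x \<noteq> y\<close> \<open>z \<in> K\<close>] .
  ultimately have "\<Psi> i z \<in> \<Psi> i ` K \<inter> \<Psi> j ` K"
    using \<open>z \<in> K\<close> by (metis IntI imageI)
  then have "z \<in> V" unfolding nested[OF ij] using sim_image_iff by blast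
  \<comment> \<open>As a vertex \<open>z\<close> would lie on the circle, but it is interior to a
    chord since \<open>L > 1\<close>.\<close>
  then have "norm (z - c) = norm (x - c)" using xy(1) by (rule norm_vertex_eq)
  moreover have "norm ((x - c) + inverse L *\<^sub>R ((y' - c) - (x - c))) < norm (x - c)"
    using norm_vertex_eq[OF xy(1) y'(1)] y'(2) L
    by (intro chord_interior_in_ball) (auto simp: inverse_less_1_iff)
  ultimately show False by (simp add: z_def algebra_simps)
qed

lemma shared_point_vertices:
  assumes ij: "i \<in> {1..N}" "j \<in> {1..N}" "i \<noteq> j"
    and xy: "x \<in> K" "y \<in> K" and eq: "\<Psi> i x = \<Psi> j y"
  shows "x \<in> V" "y \<in> V"
proof -
  have "\<Psi> i x \<in> \<Psi> i ` K \<inter> \<Psi> j ` K" "\<Psi> j y \<in> \<Psi> i ` K \<inter> \<Psi> j ` K"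
    using xy eq by (metis IntI imageI)+
  then show "x \<in> V" "y \<in> V" unfolding nested[OF ij] using sim_image_iff by blast+
qed

text \<open>Otherwise \<open>j\<close> would be the cell obtained by reflecting \<open>i\<close> in the point \<open>x\<close>, and then
  \<open>\<Psi> i \<circ> \<Psi> j = \<Psi> j \<circ> \<Psi> k\<close> for the cell \<open>k\<close> at the vertex opposite to \<open>x\<close>.\<close>

lemma vertex_in_unique_cell:
  assumes i: "i \<in> {1..N}" "x \<in> V" "\<Psi> i x = x" and j: "j \<in> {1..N}" "y \<in> K" "\<Psi> j y = x"
  shows "j = i"
proof (rule ccontr)
  assume "j \<noteq> i"
  then have ne: "i \<noteq> j" by simp
  have "x \<in> K" using i(2) vertices_subset by blast
  have eq: "\<Psi> i x = \<Psi> j y" using i(3) j(3) by simp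
  have "y \<in> V" by (rule shared_point_vertices(2)[OF i(1) j(1) ne \<open>x \<in> K\<close> j(2) eq])
  then have "x + y = 2 *\<^sub>R c" by (rule shared_vertex_opposite[OF i(1) j(1) ne i(2) _ eq])
  obtain k where k: "k \<in> {1..N}" "\<Psi> k y = y" using vertex_cell[OF \<open>y \<in> V\<close>] by blast
  have *: "\<nu> i = x - x /\<^sub>R L" "\<nu> j = x - y /\<^sub>R L" "\<nu> k = y - y /\<^sub>R L"
    using i(3) j(3) k(2) by (simp_all add: sim_def eq_diff_eq add.commute)
  \<comment> \<open>Both sides equal \<open>x + (u - y) / L^2\<close>.\<close>
  have comp: "\<Psi> i (\<Psi> j u) = \<Psi> j (\<Psi> k u)" for u
    by (simp add: sim_def * scaleR_add_right scaleR_diff_right)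
  obtain U where U: "U \<noteq> {}" "\<Psi> i ` U \<inter> \<Psi> j ` U = {}" "\<Psi> j ` U \<subseteq> U" "\<Psi> k ` U \<subseteq> U"
    using exists_open_set i(1) j(1) k(1) ne by metis
  then obtain u where "u \<in> U" by blast
  then have "\<Psi> i (\<Psi> j u) \<in> \<Psi> i ` U" "\<Psi> j (\<Psi> k u) \<in> \<Psi> j ` U" using U by blast+
  with comp U(2) show False by auto
qed

subsection \<open>Words\<close>

text \<open>\<open>p + word_shift J f\<close> is \<open>p\<close> mapped by
  \<open>\<Psi> (f 1)\<close>, then by the others up to \<open>\<Psi> (f J)\<close>, and magnified
  by \<open>L ^ J\<close>; the last letter selects the coarsest cell.\<close>

definition word_shift :: "nat \<Rightarrow> (nat \<Rightarrow> nat) \<Rightarrow> real ^ 2" where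
  "word_shift J f = (\<Sum>j=1..J. L ^ j *\<^sub>R \<nu> (f j))"

lemma word_shift_0 [simp]: "word_shift 0 f = 0"
  by (simp add: word_shift_def)

lemma word_shift_Suc: "word_shift (Suc J) f = word_shift J f + L ^ Suc J *\<^sub>R \<nu> (f (Suc J))"
  by (simp add: word_shift_def)

lemma scaled_sim: "L ^ Suc J *\<^sub>R \<Psi> i x = L ^ J *\<^sub>R x + L ^ Suc J *\<^sub>R \<nu> i"
  using L by (simp add: sim_def scaleR_add_right)

lemma word_cell:
  assumes "\<forall>j\<in>{1..J}. f j \<in> {1..N}" "p \<in> K"
  shows "\<exists>x\<in>K. L ^ J *\<^sub>R x = p + word_shift J f"
  using assms(1)
proof (induction J)
  case 0
  show ?case using assms(2) by auto
next
  case (Suc J)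
  then obtain x where x: "x \<in> K" "L ^ J *\<^sub>R x = p + word_shift J f" by force
  have "\<Psi> (f (Suc J)) x \<in> K" using x(1) Suc.prems by (intro sim_in_attractor) auto
  moreover have "L ^ Suc J *\<^sub>R \<Psi> (f (Suc J)) x = p + word_shift (Suc J) f"
    unfolding scaled_sim x(2) by (simp add: word_shift_Suc add.assoc)
  ultimately show ?case by blast
qed

text \<open>The only cell containing the vertex \<open>x\<close> is the one whose map fixes
  \<open>x\<close>, so peeling off the outermost letter leaves \<open>x\<close> in place.\<close>

lemma word_cell_at_vertex:
  assumes "\<forall>j\<in>{1..J}. f j \<in> {1..N}" "p \<in> K" "x \<in> V" "L ^ J *\<^sub>R x = p + word_shift J f"
  shows "p = x"
  using assms(1,4)
proof (induction J)
  case 0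
  then show ?case by simp
next
  case (Suc J)
  have f: "f (Suc J) \<in> {1..N}" "\<forall>j\<in>{1..J}. f j \<in> {1..N}" using Suc.prems(1) by auto
  obtain y where y: "y \<in> K" "L ^ J *\<^sub>R y = p + word_shift J f"
    using word_cell[OF f(2) assms(2)] by blast
  have "L ^ Suc J *\<^sub>R x = L ^ Suc J *\<^sub>R \<Psi> (f (Suc J)) y"
    unfolding scaled_sim y(2) Suc.prems(2) word_shift_Suc by (simp only: add.assoc)
  then have eq: "\<Psi> (f (Suc J)) y = x" using L by simp
  obtain i where i: "i \<in> {1..N}" "\<Psi> i x = x" using vertex_cell[OF assms(3)] by blast
  have "f (Suc J) = i"
    using vertex_in_unique_cell[OF i(1) assms(3) i(2) f(1) y(1) eq] .
  with eq i(2) have "y = x" by (metis sim_eq_iff)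
  with y(2) Suc.IH f(2) show ?case by simp
qed

text \<open>Equal outermost letters cancel. At the first difference two distinct cells meet, by
  nesting at vertices of theirs, and these are \<open>p\<close> and \<open>q\<close> themselves by
  \<open>word_cell_at_vertex\<close>.\<close>

lemma shared_word_vertex:
  assumes "\<forall>j\<in>{1..J}. f j \<in> {1..N}" "\<forall>j\<in>{1..J}. g j \<in> {1..N}" "p \<in> V" "q \<in> V"
    and "p + word_shift J f = q + word_shift J g"
  shows "p = q \<or> p + q = 2 *\<^sub>R c"
  using assms(1,2,5)
proof (induction J)
  case 0
  then show ?case by simp
next
  case (Suc J)
  have f: "f (Suc J) \<in> {1..N}" "\<forall>j\<in>{1..J}. f j \<in> {1..N}"
    and g: "g (Suc J) \<in> {1..N}" "\<forall>j\<in>{1..J}. g j \<in> {1..N}" using Suc.prems(1,2) by auto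
  show ?case
  proof (cases "f (Suc J) = g (Suc J)")
    case True
    then show ?thesis using Suc.IH Suc.prems(3) f(2) g(2) by (simp add: word_shift_Suc flip: add.assoc)
  next
    case False
    have pq: "p \<in> K" "q \<in> K" using assms(3,4) vertices_subset by auto
    obtain x where x: "x \<in> K" "L ^ J *\<^sub>R x = p + word_shift J f"
      using word_cell[OF f(2) pq(1)] by blast
    obtain y where y: "y \<in> K" "L ^ J *\<^sub>R y = q + word_shift J g"
      using word_cell[OF g(2) pq(2)] by blast
    have "L ^ Suc J *\<^sub>R \<Psi> (f (Suc J)) x = L ^ Suc J *\<^sub>R \<Psi> (g (Suc J)) y"
      using Suc.prems(3) unfolding scaled_sim x(2) y(2) word_shift_Suc by (simp only: add.assoc)
    then have eq: "\<Psi> (f (Suc J)) x = \<Psi> (g (Suc J)) y" using L by simp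
    note xy = shared_point_vertices[OF f(1) g(1) False x(1) y(1) eq]
    have "p = x" "q = y"
      using word_cell_at_vertex[OF f(2) pq(1) xy(1) x(2)]
        word_cell_at_vertex[OF g(2) pq(2) xy(2) y(2)] by simp_all
    then show ?thesis using shared_vertex_opposite[OF f(1) g(1) False xy eq] by simp
  qed
qed

text \<open>Padding with a letter of zero translation makes the word arbitrarily long, so that two
  shifts can be compared at a common length.\<close>

lemma zero_complex_shift_word:
  assumes "t \<in> zero_complex_shifts L N \<nu> K"
  shows "\<exists>J f. (\<forall>M\<ge>J. t = word_shift M f) \<and> (\<forall>j. f j \<in> {1..N})"
proof -
  obtain i0 where i0: "i0 \<in> {1..N}" "\<nu> i0 = 0"
    using snf by (auto simp: simple_nested_fractal_def)
  obtain J f where f: "\<And>j. j \<in> {1..J} \<Longrightarrow> f j \<in> {1..N}" "t = (\<Sum>j=1..J. L ^ j *\<^sub>R \<nu> (f j))"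
    using assms unfolding zero_complex_shifts_def by blast
  define g where "g j = (if j \<in> {1..J} then f j else i0)" for j
  have "t = word_shift M g" if "J \<le> M" for M
  proof -
    have "(\<Sum>j=1..J. L ^ j *\<^sub>R \<nu> (f j)) = (\<Sum>j=1..J. L ^ j *\<^sub>R \<nu> (g j))"
      by (intro sum.cong) (auto simp: g_def)
    also have "\<dots> = word_shift M g"
      unfolding word_shift_def using that i0 by (intro sum.mono_neutral_left) (auto simp: g_def)
    finally show ?thesis using f(2) by simp
  qed
  moreover have "g j \<in> {1..N}" for j using f(1) i0 by (simp add: g_def)
  ultimately show ?thesis by blast
qed

lemma shared_vertex_of_complexes:
  assumes "t \<in> zero_complex_shifts L N \<nu> K" "s \<in> zero_complex_shifts L N \<nu> K"
    and "p \<in> V" "q \<in> V" "p + t = q + s"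
  shows "p = q \<or> p + q = 2 *\<^sub>R c"
proof -
  obtain J f where f: "\<forall>M\<ge>J. t = word_shift M f" "\<forall>j. f j \<in> {1..N}"
    using zero_complex_shift_word[OF assms(1)] by blast
  obtain I g where g: "\<forall>M\<ge>I. s = word_shift M g" "\<forall>j. g j \<in> {1..N}"
    using zero_complex_shift_word[OF assms(2)] by blast
  have "p + word_shift (max I J) f = q + word_shift (max I J) g"
    using assms(5) f(1) g(1) by (metis max.cobounded1 max.cobounded2)
  with assms(3,4) f(2) g(2) show ?thesis by (intro shared_word_vertex) auto
qed

lemma zero_shift: "0 \<in> zero_complex_shifts L N \<nu> K"
proof -
  obtain i0 where i0: "i0 \<in> {1..N}" "\<nu> i0 = 0"
    using snf by (auto simp: simple_nested_fractal_def)
  then have "\<exists>J\<ge>1. \<exists>idx. (\<forall>j\<in>{1..J}. idx j \<in> {1..N}) \<and> 0 = (\<Sum>j=1..J. L ^ j *\<^sub>R \<nu> (idx j))"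
    \<comment> \<open>Words have length at least 1, so 0 is written with one letter of zero
      translation.\<close>
    by (intro exI[of _ 1] exI[of _ "\<lambda>_. i0"]) auto
  moreover have "K \<subseteq> unbounded_fractal L K"
    unfolding unbounded_fractal_def blow_up_def by (rule SUP_upper2[of 0]) auto
  ultimately show ?thesis by (simp add: zero_complex_shifts_def)
qed

subsection \<open>The labelling\<close>

text \<open>Every element of \<open>B\<close> is, as a complex number, a fixed \<open>w\<close>
  times a power of \<omega>, so an integer relation in \<open>B\<close> is one between powers of
  \<omega>.\<close>

lemma exists_parity:
  assumes card: "card V = 2 ^ n"
  obtains \<phi> where "\<And>t p. p \<in> V \<Longrightarrow> \<phi> (t + 2 *\<^sub>R (p - c)) \<longleftrightarrow> \<not> \<phi> t"
proof -
  define B where "B = (\<lambda>p. 2 *\<^sub>R (p - c)) ` V"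
  obtain m where m: "n = Suc m" using card card_ge by (cases n) auto
  define \<omega> where "\<omega> = cis (2 * pi / 2 ^ n)"
  have \<omega>: "\<omega> ^ (2 ^ m) = -1" by (simp add: \<omega>_def m Complex.DeMoivre)
  obtain v0 where v0: "v0 \<in> V" using V_nonempty by blast
  define w where "w = complex_of_vec (2 *\<^sub>R (v0 - c))"
  have w: "w \<noteq> 0"
    using vertices_regular_polygon(2)[OF v0] norm_complex_of_vec[of "2 *\<^sub>R (v0 - c)"] by (auto simp: w_def)
  have "\<exists>j. complex_of_vec b = w * \<omega> ^ j" if "b \<in> B" for b
  proof -
    obtain p where p: "p \<in> V" "b = 2 *\<^sub>R (p - c)" using \<open>b \<in> B\<close> by (auto simp: B_def)
    have "complex_of_vec (p - c) \<in> (\<lambda>q. complex_of_vec (v0 - c) * q) ` {q. q ^ card V = 1}"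
      using p(1) vertices_regular_polygon(1)[OF v0] by blast
    then obtain q where q: "q ^ (2 ^ n) = 1" "complex_of_vec (p - c) = complex_of_vec (v0 - c) * q"
      by (auto simp: card)
    have "q \<in> (\<lambda>j. cis (2 * pi * real j / real (2 ^ n))) ` {..<2 ^ n}"
      using q(1) by (subst bij_betw_imp_surj_on[OF Complex.bij_betw_roots_unity]) simp_all
    then obtain j where "q = cis (2 * pi * real j / real (2 ^ n))" by blast
    then have "q = \<omega> ^ j" by (simp add: \<omega>_def Complex.DeMoivre mult_ac)
    then have "complex_of_vec b = w * \<omega> ^ j"
      by (simp add: p(2) w_def q(2) linear_cmul[OF linear_complex_of_vec])
    then show ?thesis ..
  qed
  then obtain e where e: "\<And>b. b \<in> B \<Longrightarrow> complex_of_vec b = w * \<omega> ^ e b" by metis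
  have "finite B" using finite_V by (simp add: B_def)
  moreover have "even (\<Sum>b\<in>B. m b)" if "(\<Sum>b\<in>B. of_int (m b) *\<^sub>R b) = 0" for m :: "real ^ 2 \<Rightarrow> int"
  proof -
    have "0 = complex_of_vec (\<Sum>b\<in>B. of_int (m b) *\<^sub>R b)"
      unfolding that using linear_0[OF linear_complex_of_vec] by simp
    also have "\<dots> = (\<Sum>b\<in>B. of_int (m b) * complex_of_vec b)"
      unfolding linear_sum[OF linear_complex_of_vec] linear_cmul[OF linear_complex_of_vec]
      by (simp add: scaleR_conv_of_real)
    also have "\<dots> = w * (\<Sum>b\<in>B. of_int (m b) * \<omega> ^ e b)"
      unfolding sum_distrib_left by (intro sum.cong) (simp_all add: e)
    finally have "(\<Sum>b\<in>B. of_int (m b) * \<omega> ^ e b) = 0" using w by simp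
    with int_values_sum[OF \<open>finite B\<close>, of m \<omega> e] have "(0, \<Sum>b\<in>B. m b) \<in> int_values \<omega>" by simp
    then show ?thesis by (rule int_values_zero_even[OF \<omega>])
  qed
  ultimately obtain \<phi> where \<phi>: "\<And>t b. b \<in> B \<Longrightarrow> \<phi> (t + b) \<longleftrightarrow> \<not> \<phi> t"
    using exists_alternating_colouring by blast
  show thesis by (rule that[of \<phi>], rule \<phi>) (simp add: B_def)
qed

text \<open>In the plane \<open>- mat 1\<close> has determinant 1, so the point reflection in
  \<open>c\<close> is a rotation.\<close>

lemma id_and_half_turn_rotations:
  "id \<in> vertex_rotations L N \<nu>" "(\<lambda>x. 2 *\<^sub>R c - x) \<in> vertex_rotations L N \<nu>"
proof -
  have "rotation_matrix (mat 1 :: real ^ 2 ^ 2)"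
    by (simp add: rotation_matrix_def orthogonal_matrix_id)
  moreover have "id = rotation_about c (mat 1)"
    by (simp add: fun_eq_iff rotation_about_def)
  ultimately show "id \<in> vertex_rotations L N \<nu>"
    unfolding vertex_rotations_def by auto
  have "rotation_matrix (- mat 1 :: real ^ 2 ^ 2)"
    by (simp add: rotation_matrix_def orthogonal_matrix_def transpose_def matrix_matrix_mult_def
        det_2 mat_def vec_eq_iff forall_2 sum_2)
  moreover have "(- mat 1) *v x = - x" for x :: "real ^ 2"
    by (simp add: matrix_vector_mult_def mat_def vec_eq_iff forall_2 sum_2)
  then have "(\<lambda>x. 2 *\<^sub>R c - x) = rotation_about c (- mat 1)"
    by (simp add: fun_eq_iff rotation_about_def scaleR_2)
  moreover have "(\<lambda>x. 2 *\<^sub>R c - x) ` V = V"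
  proof
    show "(\<lambda>x. 2 *\<^sub>R c - x) ` V \<subseteq> V" using antipode_vertex by blast
    show "V \<subseteq> (\<lambda>x. 2 *\<^sub>R c - x) ` V"
    proof
      fix v assume "v \<in> V"
      then show "v \<in> (\<lambda>x. 2 *\<^sub>R c - x) ` V"
        using antipode_vertex by (intro image_eqI[of _ _ "2 *\<^sub>R c - v"]) auto
    qed
  qed
  ultimately show "(\<lambda>x. 2 *\<^sub>R c - x) \<in> vertex_rotations L N \<nu>"
    unfolding vertex_rotations_def by blast
qed

text \<open>Two 0-complexes sharing a vertex differ by twice a vector from the centre to a vertex, so
  turning every 0-complex of the wrong parity by \<open>\<pi>\<close> makes the labels of shared vertices agree.\<close>

lemma labelling:
  assumes "card V = 2 ^ n" "card A = card V"
  shows "good_labelling_property L N \<nu> K A"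
proof -
  let ?T = "zero_complex_shifts L N \<nu> K"
  obtain \<phi> where \<phi>: "\<And>t p. p \<in> V \<Longrightarrow> \<phi> (t + 2 *\<^sub>R (p - c)) \<longleftrightarrow> \<not> \<phi> t"
    using exists_parity[OF assms(1)] by blast
  have "finite A" using assms by (intro card_ge_0_finite) simp
  then obtain l0 where l0: "bij_betw l0 V A"
    using finite_V assms(2) finite_same_card_bij by metis
  \<comment> \<open>Parity is measured against that of 0, so that the labels on \<open>V\<close>
    itself are those of \<open>l0\<close>.\<close>
  define R where "R t = (if \<phi> t = \<phi> 0 then id else (\<lambda>x. 2 *\<^sub>R c - x))" for t
  have R: "R t \<in> vertex_rotations L N \<nu>" for t by (simp add: R_def id_and_half_turn_rotations)
  have R_V: "R t p \<in> V" if "p \<in> V" for t p using that antipode_vertex by (simp add: R_def)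
  have consistent: "R t p = R s q"
    if "t \<in> ?T" "s \<in> ?T" "p \<in> V" "q \<in> V" "p + t = q + s" for t s p q
  proof (cases "p = q")
    case True
    then show ?thesis using that(5) by simp
  next
    case False
    then have pq: "p + q = 2 *\<^sub>R c" using shared_vertex_of_complexes that by blast
    then have "p = 2 *\<^sub>R c - q" by (simp add: eq_diff_eq)
    moreover have "2 *\<^sub>R (p - c) = p - q"
      unfolding scaleR_diff_right pq[symmetric] by (simp only: scaleR_2 add_diff_cancel_left)
    then have "s = t + 2 *\<^sub>R (p - c)"
      using that(5) by (metis add.commute add_diff_eq add_diff_cancel_left')
    then have "\<phi> s \<longleftrightarrow> \<not> \<phi> t" using \<phi>[OF that(3)] by simp
    ultimately show ?thesis by (auto simp: R_def)
  qed
  \<comment> \<open>A vertex may belong to several 0-complexes; \<open>consistent\<close> makes the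
    chosen \<open>x\<close> unique.\<close>
  define P where "P v x \<longleftrightarrow> (\<exists>t\<in>?T. \<exists>p\<in>V. v = p + t \<and> x = R t p)" for v x
  define l where "l v = l0 (SOME x. P v x)" for v
  have l: "l (p + t) = l0 (R t p)" if "t \<in> ?T" "p \<in> V" for t p
  proof -
    have "P (p + t) (R t p)" using that by (auto simp: P_def)
    moreover have "x = R t p" if "P (p + t) x" for x
      using that consistent \<open>t \<in> ?T\<close> \<open>p \<in> V\<close> unfolding P_def by metis
    ultimately have "(SOME x. P (p + t) x) = R t p" by (rule some_equality)
    then show ?thesis by (simp add: l_def)
  qed
  have l_V: "l p = l0 p" if "p \<in> V" for p
    using l[OF zero_shift that] by (simp add: R_def)
  have "l \<in> all_vertices L N \<nu> K \<rightarrow> A"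
    using l R_V l0 by (auto simp: all_vertices_def complex_vertices_def bij_betw_def)
  moreover have "bij_betw l V A" using l0 l_V by (simp cong: bij_betw_cong)
  moreover have "\<exists>R\<in>vertex_rotations L N \<nu>. \<forall>v\<in>complex_vertices L N \<nu> t. l v = l (R (v - t))"
    if "t \<in> ?T" for t
    using R[of t] l[OF that] l_V R_V
    by (intro bexI[of _ "R t"]) (auto simp: complex_vertices_def)
  ultimately show ?thesis unfolding good_labelling_property_def by blast
qed

end

theorem theorem3p4:
  fixes L :: real and N n :: nat and \<nu> :: "nat \<Rightarrow> real ^ 2" and K :: "(real ^ 2) set"
    and A :: "'l set"
  assumes "simple_nested_fractal L N \<nu> K"
    and "n > 1"
    and "card (essential_fixed_points L N \<nu>) = 2 ^ n"
    and "card A = card (essential_fixed_points L N \<nu>)"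
  shows "good_labelling_property L N \<nu> K A"
proof -
  \<comment> \<open>At least four vertices, enough for the bound in the locale.\<close>
  have "(2::nat) ^ 2 \<le> 2 ^ n" using assms(2) by (intro power_increasing) auto
  then interpret even_nested_fractal L N \<nu> K
    using assms by unfold_locales auto
  show ?thesis using assms(3,4) by (rule labelling)
qed

end
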